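(* Let $K_0$ be a field and $S=K_0[x_1,\ldots,x_n]$. Let $J_1,\ldots,J_s,K\subseteq [n]$ be such that $J_i\cap J_j=\bigcap_{t=1}^s J_t$ for all $1\leq i<j\leq s$ and $K\cap J_t=\emptyset$ for all $t=1,\ldots,s$. Then for any positive integers $a_1,\ldots,a_s,b$, the ideal $$I=\mathfrak{m}_{J_1}^{a_1}\cap \mathfrak{m}_{J_2}^{a_2}\cap\cdots\cap \mathfrak{m}_{J_s}^{a_s}\cap \mathfrak{m}_K^{b}\subset S$$ has the non-pure dual exchange property.
   Context: $[n]=\{1,\ldots,n\}$. For $J\subseteq[n]$, $\mathfrak{m}_J$ denotes the ideal of $S$ generated by the variables $x_i$ with $i\in J$. (The coefficient field is written $K_0$ to distinguish it from the subset $K\subseteq[n]$.) For a monomial ideal $I\subset S$, $G(I)$ denotes its unique minimal set of monomial generators. For a monomial $u$, $\deg_{x_i}(u)$ denotes the exponent of $x_i$ in $u$, and $\deg(u)$ its total degree. Non-pure dual exchange property: a monomial ideal $I$ satisfies the non-pure dual exchange property if, for all $u,v\in G(I)$ with $\deg(u)\leq \deg(v)$ and for all $i$ such that $\deg_{x_i}(v)<\deg_{x_i}(u)$, there exists $j$ such that $\deg_{x_j}(v)>\deg_{x_j}(u)$ and $x_i(v/x_j)\in I$. *)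

theory Defs
  imports "HOL-Library.Poly_Mapping" "HOL-Algebra.Ideal_Product"
begin

text \<open>
  A monomial is identified with its exponent vector \<open>u :: nat \<Rightarrow>\<^sub>0 nat\<close>, where variables are
  indexed by natural numbers; a polynomial is a finitely supported function from monomials to
  coefficients. Multiplication of monomials is addition of exponent vectors.
\<close>

type_synonym monom = "nat \<Rightarrow>\<^sub>0 nat"

definition monoms :: "nat \<Rightarrow> monom set" where
  "monoms n = {u. Poly_Mapping.keys u \<subseteq> {1..n}}"

definition poly_ring_in :: "nat \<Rightarrow> (monom \<Rightarrow>\<^sub>0 'k::field) ring" where
  "poly_ring_in n = \<lparr>carrier = {p. Poly_Mapping.keys p \<subseteq> monoms n},
     monoid.mult = (*), one = 1, ring.zero = 0, add = (+)\<rparr>"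

definition mon_poly :: "monom \<Rightarrow> (monom \<Rightarrow>\<^sub>0 'k::field)" where
  "mon_poly u = Poly_Mapping.single u 1"

definition var_monom :: "nat \<Rightarrow> monom" where
  "var_monom i = Poly_Mapping.single i 1"

abbreviation var_deg :: "nat \<Rightarrow> monom \<Rightarrow> nat" where
  "var_deg i u \<equiv> Poly_Mapping.lookup u i"

definition total_deg :: "monom \<Rightarrow> nat" where
  "total_deg u = (\<Sum>i\<in>Poly_Mapping.keys u. var_deg i u)"

definition var_ideal :: "nat \<Rightarrow> nat set \<Rightarrow> (monom \<Rightarrow>\<^sub>0 'k::field) set" where
  "var_ideal n J = Idl\<^bsub>poly_ring_in n\<^esub> ((\<lambda>i. mon_poly (var_monom i)) ` J)"

text \<open>Powers of ideals are powers in the semiring of ideals, i.e. iterated \<^const>\<open>ideal_prod\<close>.\<close>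

definition ideal_pow ::
    "nat \<Rightarrow> (monom \<Rightarrow>\<^sub>0 'k::field) set \<Rightarrow> nat \<Rightarrow> (monom \<Rightarrow>\<^sub>0 'k) set" where
  "ideal_pow n I a = I [^]\<^bsub>ideals_set (poly_ring_in n)\<^esub> a"

definition monom_gens :: "nat \<Rightarrow> (monom \<Rightarrow>\<^sub>0 'k::field) set \<Rightarrow> monom set \<Rightarrow> bool" where
  "monom_gens n I U \<longleftrightarrow> U \<subseteq> monoms n \<and> I = Idl\<^bsub>poly_ring_in n\<^esub> (mon_poly ` U)"

definition monomial_ideal :: "nat \<Rightarrow> (monom \<Rightarrow>\<^sub>0 'k::field) set \<Rightarrow> bool" where
  "monomial_ideal n I \<longleftrightarrow> (\<exists>U. monom_gens n I U)"

text \<open>Meaningful only if \<open>I\<close> is a monomial ideal.\<close>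

definition min_gens :: "nat \<Rightarrow> (monom \<Rightarrow>\<^sub>0 'k::field) set \<Rightarrow> monom set" where
  "min_gens n I = (THE U. monom_gens n I U \<and> (\<forall>V. V \<subset> U \<longrightarrow> \<not> monom_gens n I V))"

text \<open>
  The truncated difference \<open>v - var_monom j\<close> is the exponent vector of \<open>v / x\<^sub>j\<close>, since
  \<open>var_deg j v > 0\<close> there.
\<close>

definition nonpure_dual_exchange :: "nat \<Rightarrow> (monom \<Rightarrow>\<^sub>0 'k::field) set \<Rightarrow> bool" where
  "nonpure_dual_exchange n I \<longleftrightarrow> monomial_ideal n I \<and>
     (\<forall>u \<in> min_gens n I. \<forall>v \<in> min_gens n I. total_deg u \<le> total_deg v \<longrightarrow>
        (\<forall>i \<in> {1..n}. var_deg i v < var_deg i u \<longrightarrow>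
           (\<exists>j \<in> {1..n}. var_deg j v > var_deg j u \<and>
              mon_poly (var_monom i + (v - var_monom j)) \<in> I)))"

lemma keys_mult_monoms:
  assumes "Poly_Mapping.keys p \<subseteq> monoms n" "Poly_Mapping.keys q \<subseteq> monoms n"
  shows "Poly_Mapping.keys (p * q :: monom \<Rightarrow>\<^sub>0 'k::field) \<subseteq> monoms n"
proof -
  have "u + v \<in> monoms n" if "u \<in> monoms n" "v \<in> monoms n" for u v
    using that Poly_Mapping.keys_add[of u v] by (auto simp: monoms_def)
  with assms show ?thesis using Poly_Mapping.keys_mult[of p q] by blast
qed

lemma cring_poly_ring_in: "cring (poly_ring_in n :: (monom \<Rightarrow>\<^sub>0 'k::field) ring)"
proof (rule cringI)
  show "abelian_group (poly_ring_in n :: (monom \<Rightarrow>\<^sub>0 'k) ring)"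
  proof (rule abelian_groupI)
    fix x :: "monom \<Rightarrow>\<^sub>0 'k" assume "x \<in> carrier (poly_ring_in n)"
    then show "\<exists>y\<in>carrier (poly_ring_in n). y \<oplus>\<^bsub>poly_ring_in n\<^esub> x = \<zero>\<^bsub>poly_ring_in n\<^esub>"
      by (intro bexI[of _ "- x"]) (auto simp: poly_ring_in_def keys_minus)
  next
    fix x y :: "monom \<Rightarrow>\<^sub>0 'k"
    assume "x \<in> carrier (poly_ring_in n)" "y \<in> carrier (poly_ring_in n)"
    then show "x \<oplus>\<^bsub>poly_ring_in n\<^esub> y \<in> carrier (poly_ring_in n)"
      using Poly_Mapping.keys_add[of x y] by (auto simp: poly_ring_in_def)
  qed (auto simp: poly_ring_in_def algebra_simps)
  show "comm_monoid (poly_ring_in n :: (monom \<Rightarrow>\<^sub>0 'k) ring)"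
  proof (rule comm_monoidI)
    fix x y :: "monom \<Rightarrow>\<^sub>0 'k"
    assume "x \<in> carrier (poly_ring_in n)" "y \<in> carrier (poly_ring_in n)"
    then show "x \<otimes>\<^bsub>poly_ring_in n\<^esub> y \<in> carrier (poly_ring_in n)"
      using keys_mult_monoms[of x n y] by (simp add: poly_ring_in_def)
  qed (auto simp: poly_ring_in_def monoms_def algebra_simps)
qed (auto simp: poly_ring_in_def algebra_simps)

end

theory Submission
  imports Defs
begin

text \<open>
  Membership in \<open>I\<close> can be read off from exponents: the powers of \<open>\<mm>\<^sub>J\<close> are spanned by the
  monomials of degree at least \<open>a\<close> in the variables of \<open>J\<close> (\<open>ideal_pow_var_ideal\<close>), so \<open>I\<close> is
  spanned by the set \<open>P\<close> of monomials \<open>w\<close> whose degree is at least \<open>a\<^sub>t\<close> on every \<open>J\<^sub>t\<close> and at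
  least \<open>b\<close> on \<open>K\<close>. The minimal generators are then the elements of \<open>P\<close> that leave \<open>P\<close> when
  any variable is divided out (\<open>min_gens_poly_span\<close>), and the theorem becomes a statement about
  exponent vectors.

  The sets \<open>J\<^sub>t\<close> (if there are any) form a sunflower with core \<open>C = \<Inter>J\<^sub>t\<close> and disjoint
  petals \<open>D\<^sub>t = J\<^sub>t - C\<close>. A minimal \<open>u\<close> of core degree \<open>c\<close> has degree \<open>b\<close> on \<open>K\<close> and exactly \<open>max(0, a\<^sub>t - c)\<close> on \<open>D\<^sub>t\<close>;
  moreover \<open>c \<le> max\<^sub>t a\<^sub>t\<close>. Hence \<open>deg u = b + c + \<Sum>\<^sub>t max(0, a\<^sub>t - c)\<close>, which is a
  nonincreasing function of \<open>c\<close> in the admissible range, constant precisely where a single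
  \<open>a\<^sub>t\<close> exceeds \<open>c\<close> (\<open>truncated_sum_rigidity\<close>).

  Let \<open>u, v\<close> be minimal with \<open>deg u \<le> deg v\<close> and \<open>v\<^sub>i < u\<^sub>i\<close>. If the part among \<open>K, C, D\<^sub>t\<close> that
  contains \<open>i\<close> also contains some \<open>j\<close> with \<open>v\<^sub>j > u\<^sub>j\<close>, exchanging inside that part preserves all
  conditions. Otherwise \<open>v\<close> has smaller degree than \<open>u\<close> on that part, which cannot be \<open>K\<close>. If it
  is \<open>C\<close>, then \<open>v\<close> must have larger degree on the petal with the largest \<open>a\<^sub>t\<close>, and \<open>j\<close> is taken
  there: trading a petal variable for a core variable does no harm. The delicate case is
  \<open>i \<in> D\<^sub>t\<close>: now \<open>v\<close> has larger core degree, \<open>j\<close> has to be taken in the core, and dividing by \<open>x\<^sub>j\<close>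
  might violate the condition on some other \<open>J\<^sub>r\<close>. This is where the degrees enter: \<open>deg u \<le> deg v\<close>
  forces the degree function to be constant between the two core degrees, so
  \<open>a\<^sub>r\<close> is at most the core degree of \<open>u\<close> for all \<open>r \<noteq> t\<close>, and the core of \<open>v\<close> alone keeps the
  condition on \<open>J\<^sub>r\<close> strictly satisfied.
\<close>

section \<open>Ideals spanned by monomials\<close>

definition poly_span :: "monom set \<Rightarrow> (monom \<Rightarrow>\<^sub>0 'k::field) set" where
  "poly_span P = {p. Poly_Mapping.keys p \<subseteq> P}"

definition multiples :: "nat \<Rightarrow> monom set \<Rightarrow> monom set" where
  "multiples n U = {u + z | u z. u \<in> U \<and> z \<in> monoms n}"

lemma zero_in_monoms [simp]: "0 \<in> monoms n"
  by (simp add: monoms_def)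

lemma add_in_monoms: "u \<in> monoms n \<Longrightarrow> v \<in> monoms n \<Longrightarrow> u + v \<in> monoms n"
  using Poly_Mapping.keys_add[of u v] by (auto simp: monoms_def)

lemma keys_diff_subset: "Poly_Mapping.keys (u - v :: monom) \<subseteq> Poly_Mapping.keys u"
  by (auto simp: in_keys_iff lookup_minus)

lemma diff_in_monoms: "u \<in> monoms n \<Longrightarrow> u - v \<in> monoms n"
  using keys_diff_subset[of u v] by (auto simp: monoms_def)

lemma var_monom_in_monoms: "i \<in> {1..n} \<Longrightarrow> var_monom i \<in> monoms n"
  by (simp add: monoms_def var_monom_def)

lemma lookup_var_monom: "var_deg j (var_monom i) = (if j = i then 1 else 0)"
  by (simp add: var_monom_def lookup_single when_def)

lemma var_monom_add_diff:
  assumes "i \<in> Poly_Mapping.keys u" shows "var_monom i + (u - var_monom i) = u"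
  using assms
  by (intro poly_mapping_eqI) (auto simp: lookup_add lookup_minus lookup_var_monom in_keys_iff)

lemma subset_multiples: "U \<subseteq> multiples n U"
  unfolding multiples_def by (force intro: exI[of _ 0])

lemma multiples_subset_monoms: "U \<subseteq> monoms n \<Longrightarrow> multiples n U \<subseteq> monoms n"
  unfolding multiples_def by (auto intro: add_in_monoms)

lemma multiples_multiples: "multiples n (multiples n U) \<subseteq> multiples n U"
proof
  fix w assume "w \<in> multiples n (multiples n U)"
  then obtain u z z' where "u \<in> U" "z \<in> monoms n" "z' \<in> monoms n" "w = u + (z + z')"
    unfolding multiples_def by (auto simp: add.assoc)
  then show "w \<in> multiples n U"
    unfolding multiples_def using add_in_monoms by blast
qed

lemma mon_poly_in_poly_span [simp]: "(mon_poly u :: monom \<Rightarrow>\<^sub>0 'k::field) \<in> poly_span P \<longleftrightarrow> u \<in> P"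
  by (simp add: mon_poly_def poly_span_def)

lemma poly_span_inject:
  assumes "poly_span P = (poly_span Q :: (monom \<Rightarrow>\<^sub>0 'k::field) set)" shows "P = Q"
proof -
  have "u \<in> P \<longleftrightarrow> u \<in> Q" for u
    using assms mon_poly_in_poly_span[where 'k = 'k, of u] by blast
  then show ?thesis by blast
qed

lemma ideal_poly_span:
  assumes "P \<subseteq> monoms n" "multiples n P \<subseteq> P"
  shows "ideal (poly_span P :: (monom \<Rightarrow>\<^sub>0 'k::field) set) (poly_ring_in n)"
proof -
  let ?R = "poly_ring_in n :: (monom \<Rightarrow>\<^sub>0 'k) ring"
  interpret cring ?R by (rule cring_poly_ring_in)
  have minus: "\<ominus>\<^bsub>?R\<^esub> p = - p" if "p \<in> poly_span P" for p
  proof (rule minus_equality)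
    show "- p \<oplus>\<^bsub>?R\<^esub> p = \<zero>\<^bsub>?R\<^esub>" by (simp add: poly_ring_in_def)
  qed (use that assms in \<open>auto simp: poly_ring_in_def poly_span_def\<close>)
  have mult: "x * p \<in> poly_span P" if "x \<in> carrier ?R" "p \<in> poly_span P" for x p :: "monom \<Rightarrow>\<^sub>0 'k"
  proof -
    have "Poly_Mapping.keys x \<subseteq> monoms n" "Poly_Mapping.keys p \<subseteq> P"
      using that by (auto simp: poly_ring_in_def poly_span_def)
    then have "w \<in> P" if "w \<in> Poly_Mapping.keys (x * p)" for w
      using that Poly_Mapping.keys_mult[of x p] assms(2)
      unfolding multiples_def by (fastforce simp: add.commute)
    then show ?thesis by (auto simp: poly_span_def)
  qed
  show ?thesis
  proof (rule idealI)
    show "ring ?R" by (rule ring_axioms)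
    show "subgroup (poly_span P) (add_monoid ?R)"
    proof (rule add.subgroupI)
      show "poly_span P \<subseteq> carrier ?R"
        using assms(1) by (auto simp: poly_ring_in_def poly_span_def)
      show "poly_span P \<noteq> ({} :: (monom \<Rightarrow>\<^sub>0 'k) set)"
        by (auto simp: poly_span_def intro: exI[of _ 0])
      show "\<ominus>\<^bsub>?R\<^esub> p \<in> poly_span P" if "p \<in> poly_span P" for p
        using that minus by (simp add: poly_span_def)
      show "p \<oplus>\<^bsub>?R\<^esub> q \<in> poly_span P" if "p \<in> poly_span P" "q \<in> poly_span P" for p q
        using that Poly_Mapping.keys_add[of p q] by (auto simp: poly_ring_in_def poly_span_def)
    qed
    show "x \<otimes>\<^bsub>?R\<^esub> p \<in> poly_span P" "p \<otimes>\<^bsub>?R\<^esub> x \<in> poly_span P"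
      if "p \<in> poly_span P" "x \<in> carrier ?R" for p x
      using mult[OF that(2,1)] by (simp_all add: poly_ring_in_def mult.commute)
  qed
qed

lemma poly_mapping_eq_sum_single:
  "p = (\<Sum>k\<in>Poly_Mapping.keys p. Poly_Mapping.single k (Poly_Mapping.lookup p k))"
  by (rule poly_mapping_eqI)
    (auto simp: lookup_sum lookup_single when_def in_keys_iff sum.delta)

text \<open>
  A polynomial is the sum of its terms, and each term is a multiple of a generating monomial.
\<close>

lemma poly_span_multiples_subset:
  fixes A :: "(monom \<Rightarrow>\<^sub>0 'k::field) set"
  assumes A: "ideal A (poly_ring_in n)" and U: "mon_poly ` U \<subseteq> A"
  shows "poly_span (multiples n U) \<subseteq> A"
proof
  let ?R = "poly_ring_in n :: (monom \<Rightarrow>\<^sub>0 'k) ring"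
  interpret ideal A ?R by (rule A)
  fix p :: "monom \<Rightarrow>\<^sub>0 'k" assume p: "p \<in> poly_span (multiples n U)"
  have term_in: "Poly_Mapping.single w c \<in> A" if w: "w \<in> multiples n U" for w c
  proof -
    obtain u z where uz: "w = u + z" "u \<in> U" "z \<in> monoms n"
      using w unfolding multiples_def by blast
    have "Poly_Mapping.single z c \<otimes>\<^bsub>?R\<^esub> mon_poly u \<in> A"
      using U uz by (intro I_l_closed) (auto simp: poly_ring_in_def)
    then show ?thesis
      by (simp add: poly_ring_in_def mon_poly_def mult_single uz(1) add.commute)
  qed
  have zero: "0 \<in> A"
    using additive_subgroup.zero_closed[OF ideal.axioms(1)[OF A]] by (simp add: poly_ring_in_def)
  have add: "x + y \<in> A" if "x \<in> A" "y \<in> A" for x y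
    using additive_subgroup.a_closed[OF ideal.axioms(1)[OF A] that] by (simp add: poly_ring_in_def)
  have "(\<Sum>k\<in>F. Poly_Mapping.single k (Poly_Mapping.lookup p k)) \<in> A"
    if "finite F" "F \<subseteq> Poly_Mapping.keys p" for F
    using that
  proof (induction F rule: finite_induct)
    case (insert k F)
    then show ?case using p by (auto simp: poly_span_def intro!: add term_in)
  qed (simp add: zero)
  then show "p \<in> A"
    using poly_mapping_eq_sum_single[of p] by (metis finite_keys order_refl)
qed

lemma genideal_mon_poly:
  assumes "U \<subseteq> monoms n"
  shows "Idl\<^bsub>poly_ring_in n\<^esub> (mon_poly ` U :: (monom \<Rightarrow>\<^sub>0 'k::field) set)
    = poly_span (multiples n U)"
proof
  let ?R = "poly_ring_in n :: (monom \<Rightarrow>\<^sub>0 'k) ring"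
  interpret cring ?R by (rule cring_poly_ring_in)
  have carr: "mon_poly ` U \<subseteq> carrier ?R"
    using assms by (auto simp: poly_ring_in_def mon_poly_def)
  show "Idl\<^bsub>?R\<^esub> (mon_poly ` U) \<subseteq> poly_span (multiples n U)"
    using subset_multiples[of U n]
    by (intro genideal_minimal ideal_poly_span multiples_subset_monoms multiples_multiples assms)
      auto
  show "poly_span (multiples n U) \<subseteq> Idl\<^bsub>?R\<^esub> (mon_poly ` U)"
    by (intro poly_span_multiples_subset genideal_ideal genideal_self carr)
qed

lemma monom_gens_poly_span_iff:
  "monom_gens n (poly_span P :: (monom \<Rightarrow>\<^sub>0 'k::field) set) U
    \<longleftrightarrow> U \<subseteq> monoms n \<and> multiples n U = P"
  unfolding monom_gens_def
  using genideal_mon_poly[where 'k = 'k, of U n] poly_span_inject[where 'k = 'k] by metis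

section \<open>Minimal monomial generators\<close>

definition minimal_monoms :: "monom set \<Rightarrow> monom set" where
  "minimal_monoms P = {u \<in> P. \<forall>i\<in>Poly_Mapping.keys u. u - var_monom i \<notin> P}"

text \<open>Dividing out variables for as long as possible ends at a minimal monomial.\<close>

lemma multiples_minimal_monoms:
  assumes "P \<subseteq> monoms n" "multiples n P \<subseteq> P"
  shows "multiples n (minimal_monoms P) = P"
proof
  show "multiples n (minimal_monoms P) \<subseteq> P"
    using assms(2) unfolding multiples_def minimal_monoms_def by blast
  have "w \<in> multiples n (minimal_monoms P)" if "w \<in> P" "(\<Sum>i\<in>{1..n}. var_deg i w) = d" for w d
    using that
  proof (induction d arbitrary: w rule: less_induct)
    case (less d)
    show ?case
    proof (cases "w \<in> minimal_monoms P")
      case True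
      then show ?thesis using subset_multiples by blast
    next
      case False
      then obtain i where i: "i \<in> Poly_Mapping.keys w" "w - var_monom i \<in> P"
        using less.prems by (auto simp: minimal_monoms_def)
      have i_le: "i \<in> {1..n}" using i(1) less.prems(1) assms(1) unfolding monoms_def by blast
      have "(\<Sum>k\<in>{1..n}. var_deg k (w - var_monom i)) < (\<Sum>k\<in>{1..n}. var_deg k w)"
        using i(1) i_le by (intro sum_strict_mono_ex1)
          (auto simp: lookup_minus lookup_var_monom in_keys_iff intro!: bexI[of _ i])
      then have "w - var_monom i \<in> multiples n (minimal_monoms P)"
        using less.IH i(2) less.prems(2) by blast
      then have "(w - var_monom i) + var_monom i \<in> multiples n (multiples n (minimal_monoms P))"
        using var_monom_in_monoms[OF i_le] unfolding multiples_def by blast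
      then show ?thesis
        using multiples_multiples var_monom_add_diff[OF i(1)] by (metis add.commute subsetD)
    qed
  qed
  then show "P \<subseteq> multiples n (minimal_monoms P)" by blast
qed

text \<open>
  A minimal monomial \<open>w\<close> that is a proper multiple \<open>u + z\<close> of a generator could be divided by a
  variable of \<open>z\<close> and would still be a multiple of \<open>u\<close>.
\<close>

lemma minimal_monoms_subset_generators:
  assumes "multiples n U = P"
  shows "minimal_monoms P \<subseteq> U"
proof
  fix w assume w: "w \<in> minimal_monoms P"
  then obtain u z where uz: "w = u + z" "u \<in> U" "z \<in> monoms n"
    using assms unfolding minimal_monoms_def multiples_def by blast
  have "z = 0"
  proof (rule ccontr)
    assume "z \<noteq> 0"
    then obtain i where i: "i \<in> Poly_Mapping.keys z"
      using keys_eq_empty by blast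
    have "w - var_monom i = u + (z - var_monom i)"
      using i unfolding uz(1)
      by (intro poly_mapping_eqI) (auto simp: lookup_add lookup_minus lookup_var_monom in_keys_iff)
    then have "w - var_monom i \<in> P"
      using uz diff_in_monoms assms unfolding multiples_def by blast
    moreover have "i \<in> Poly_Mapping.keys w"
      using i by (simp add: uz(1) in_keys_iff lookup_add)
    ultimately show False using w by (simp add: minimal_monoms_def)
  qed
  then show "w \<in> U" using uz by simp
qed

text \<open>
  The minimal monomials generate the ideal and lie in every monomial generating set, so they are
  the only generating set without a proper generating subset. In particular the definite
  description in \<^const>\<open>min_gens\<close> denotes.
\<close>

lemma min_gens_poly_span:
  fixes P n
  defines "A \<equiv> poly_span P :: (monom \<Rightarrow>\<^sub>0 'k::field) set"
  assumes "P \<subseteq> monoms n" "multiples n P \<subseteq> P"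
  shows "monomial_ideal n A" and "min_gens n A = minimal_monoms P"
proof -
  have gens: "monom_gens n A (minimal_monoms P)"
    using multiples_minimal_monoms[OF assms(2,3)] assms(2)
    unfolding A_def monom_gens_poly_span_iff by (auto simp: minimal_monoms_def)
  then show "monomial_ideal n A" unfolding monomial_ideal_def by blast
  have least: "minimal_monoms P \<subseteq> V" if "monom_gens n A V" for V
    using that minimal_monoms_subset_generators unfolding A_def monom_gens_poly_span_iff by blast
  show "min_gens n A = minimal_monoms P"
    unfolding min_gens_def
  proof (rule the_equality)
    show "monom_gens n A (minimal_monoms P)
        \<and> (\<forall>V. V \<subset> minimal_monoms P \<longrightarrow> \<not> monom_gens n A V)"
      using gens least by blast
  next
    fix U assume "monom_gens n A U \<and> (\<forall>V. V \<subset> U \<longrightarrow> \<not> monom_gens n A V)"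
    then show "U = minimal_monoms P" using gens least by blast
  qed
qed

section \<open>Powers of ideals generated by variables\<close>

definition part_deg :: "nat set \<Rightarrow> monom \<Rightarrow> nat" where
  "part_deg A u = (\<Sum>i\<in>A. var_deg i u)"

lemma part_deg_add: "part_deg A (u + v) = part_deg A u + part_deg A v"
  by (simp add: part_deg_def lookup_add sum.distrib)

lemma part_deg_var_monom:
  "finite A \<Longrightarrow> part_deg A (var_monom i) = (if i \<in> A then 1 else 0)"
  by (simp add: part_deg_def lookup_var_monom)

lemma part_deg_diff_var_monom:
  assumes "finite A" "i \<in> Poly_Mapping.keys u"
  shows "part_deg A u = part_deg A (u - var_monom i) + (if i \<in> A then 1 else 0)"
  using part_deg_add[of A "var_monom i" "u - var_monom i"] part_deg_var_monom[OF assms(1), of i]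
    var_monom_add_diff[OF assms(2)] by simp

lemma part_deg_Un:
  "finite A \<Longrightarrow> finite B \<Longrightarrow> A \<inter> B = {} \<Longrightarrow> part_deg (A \<union> B) u = part_deg A u + part_deg B u"
  by (simp add: part_deg_def sum.union_disjoint)

lemma part_deg_pos:
  assumes "0 < part_deg A u" obtains i where "i \<in> A" "i \<in> Poly_Mapping.keys u"
proof -
  have "\<exists>i\<in>A. var_deg i u \<noteq> 0"
    using assms unfolding part_deg_def by (metis less_numeral_extra(3) sum.neutral)
  then show thesis using that by (auto simp: in_keys_iff)
qed

definition deg_at_least :: "nat \<Rightarrow> nat set \<Rightarrow> nat \<Rightarrow> monom set" where
  "deg_at_least n J a = {w \<in> monoms n. a \<le> part_deg J w}"

lemma deg_at_least_subset: "deg_at_least n J a \<subseteq> monoms n"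
  by (auto simp: deg_at_least_def)

lemma multiples_deg_at_least: "multiples n (deg_at_least n J a) \<subseteq> deg_at_least n J a"
  by (auto simp: multiples_def deg_at_least_def part_deg_add intro: add_in_monoms)

lemma var_ideal_eq_poly_span:
  assumes "J \<subseteq> {1..n}"
  shows "var_ideal n J = (poly_span (deg_at_least n J 1) :: (monom \<Rightarrow>\<^sub>0 'k::field) set)"
proof -
  have fin: "finite J" using assms by (rule finite_subset) simp
  have "multiples n (var_monom ` J) = deg_at_least n J 1"
  proof
    show "multiples n (var_monom ` J) \<subseteq> deg_at_least n J 1"
      using assms fin
      by (auto simp: multiples_def deg_at_least_def part_deg_add part_deg_var_monom
          intro!: add_in_monoms var_monom_in_monoms)
    show "deg_at_least n J 1 \<subseteq> multiples n (var_monom ` J)"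
    proof
      fix w assume w: "w \<in> deg_at_least n J 1"
      then have "0 < part_deg J w" by (simp add: deg_at_least_def)
      then obtain i where i: "i \<in> J" "i \<in> Poly_Mapping.keys w" by (rule part_deg_pos)
      then show "w \<in> multiples n (var_monom ` J)"
        using var_monom_add_diff[OF i(2)] diff_in_monoms[of w n] w
        unfolding multiples_def deg_at_least_def by (metis (mono_tags, lifting) imageI mem_Collect_eq)
    qed
  qed
  moreover have "var_monom ` J \<subseteq> monoms n"
    using assms var_monom_in_monoms by blast
  ultimately show ?thesis
    unfolding var_ideal_def using genideal_mon_poly[where 'k = 'k, of "var_monom ` J" n]
    by (simp add: image_image)
qed

lemma ideal_prod_poly_span:
  assumes "P \<subseteq> monoms n" "multiples n P \<subseteq> P" "Q \<subseteq> monoms n" "multiples n Q \<subseteq> Q"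
  shows "ideal_prod (poly_ring_in n) (poly_span P) (poly_span Q)
    = (poly_span {x + y | x y. x \<in> P \<and> y \<in> Q} :: (monom \<Rightarrow>\<^sub>0 'k::field) set)"
    (is "?L = poly_span ?S")
proof
  let ?R = "poly_ring_in n :: (monom \<Rightarrow>\<^sub>0 'k) ring"
  interpret cring ?R by (rule cring_poly_ring_in)
  show "?L \<subseteq> poly_span ?S"
  proof
    fix p assume "p \<in> ?L"
    then show "p \<in> poly_span ?S"
    proof (induction p rule: ideal_prod.induct)
      case (prod p q)
      have "w \<in> ?S" if "w \<in> Poly_Mapping.keys (p * q)" for w
        using that Poly_Mapping.keys_mult[of p q] prod by (fastforce simp: poly_span_def)
      then show ?case by (auto simp: poly_span_def poly_ring_in_def)
    next
      case (sum p q)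
      then show ?case
        using Poly_Mapping.keys_add[of p q] by (simp add: poly_span_def poly_ring_in_def) blast
    qed
  qed
  have "mon_poly (x + y) \<in> ?L" if "x \<in> P" "y \<in> Q" for x y
  proof -
    have "mon_poly x \<otimes>\<^bsub>?R\<^esub> mon_poly y \<in> ?L"
      using that by (intro ideal_prod.prod) simp_all
    then show ?thesis by (simp add: poly_ring_in_def mon_poly_def mult_single)
  qed
  then have "mon_poly ` ?S \<subseteq> ?L" by blast
  then have "poly_span (multiples n ?S) \<subseteq> ?L"
    by (intro poly_span_multiples_subset ideal_prod_is_ideal ideal_poly_span assms)
  then show "poly_span ?S \<subseteq> ?L"
    using subset_multiples[of ?S n] unfolding poly_span_def by blast
qed

text \<open>
  A monomial of degree at least \<open>a + 1\<close> in the variables of \<open>J\<close> contains one of them, and splitting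
  that variable off leaves degree at least \<open>a\<close>; thus each further factor \<open>\<mm>\<^sub>J\<close> raises the degree
  bound by one. If \<open>J\<close> is empty, both sides are the whole ring for \<open>a = 0\<close> and the zero ideal
  otherwise.
\<close>

lemma ideal_pow_var_ideal:
  assumes "J \<subseteq> {1..n}"
  shows "ideal_pow n (var_ideal n J) a
    = (poly_span (deg_at_least n J a) :: (monom \<Rightarrow>\<^sub>0 'k::field) set)"
proof (induction a)
  case 0
  show ?case
    by (auto simp: ideal_pow_def nat_pow_def ideals_set_def poly_ring_in_def poly_span_def
        deg_at_least_def)
next
  case (Suc a)
  have fin: "finite J" using assms by (rule finite_subset) simp
  have split: "{x + y | x y. x \<in> deg_at_least n J a \<and> y \<in> deg_at_least n J 1}
      = deg_at_least n J (Suc a)" (is "?S = _")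
  proof
    show "?S \<subseteq> deg_at_least n J (Suc a)"
      by (auto simp: deg_at_least_def part_deg_add intro: add_in_monoms)
    show "deg_at_least n J (Suc a) \<subseteq> ?S"
    proof
      fix w assume w: "w \<in> deg_at_least n J (Suc a)"
      then have "0 < part_deg J w" by (simp add: deg_at_least_def)
      then obtain i where i: "i \<in> J" "i \<in> Poly_Mapping.keys w" by (rule part_deg_pos)
      have "w = (w - var_monom i) + var_monom i"
        using var_monom_add_diff[OF i(2)] by (simp add: add.commute)
      moreover have "w - var_monom i \<in> deg_at_least n J a"
        using w i part_deg_diff_var_monom[OF fin i(2)]
        by (simp add: deg_at_least_def diff_in_monoms)
      moreover have "var_monom i \<in> deg_at_least n J 1"
        using i(1) fin var_monom_in_monoms[OF subsetD[OF assms i(1)]]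
        by (simp add: deg_at_least_def part_deg_var_monom)
      ultimately show "w \<in> ?S" by blast
    qed
  qed
  have "ideal_pow n (var_ideal n J) (Suc a)
      = ideal_prod (poly_ring_in n) (ideal_pow n (var_ideal n J :: (monom \<Rightarrow>\<^sub>0 'k) set) a)
          (var_ideal n J)"
    by (simp add: ideal_pow_def nat_pow_def ideals_set_def)
  also have "\<dots> = poly_span ?S"
    unfolding Suc.IH unfolding var_ideal_eq_poly_span[OF assms]
    by (intro ideal_prod_poly_span deg_at_least_subset multiples_deg_at_least)
  finally show ?case unfolding split .
qed

section \<open>Exchange for sunflowers\<close>

lemma part_deg_less_witness:
  assumes "part_deg A u < part_deg A v"
  obtains j where "j \<in> A" "var_deg j u < var_deg j v"
  using assms sum_mono[of A "\<lambda>i. var_deg i v" "\<lambda>i. var_deg i u"]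
  unfolding part_deg_def by (metis not_le)

lemma part_deg_exchange_witness:
  assumes "finite A" "part_deg A u \<le> part_deg A v" "i \<in> A" "var_deg i v < var_deg i u"
  obtains j where "j \<in> A" "var_deg j u < var_deg j v"
proof (cases "\<exists>j\<in>A. var_deg j u < var_deg j v")
  case False
  then have "part_deg A v < part_deg A u"
    unfolding part_deg_def using assms by (intro sum_strict_mono_ex1) (auto simp: not_less)
  then show thesis using assms(2) by simp
qed (use that in blast)

text \<open>
  Up to the constant \<open>b\<close>, \<open>c + (\<Sum>t\<in>T. a t - c)\<close> is the degree of a minimal monomial of core
  degree \<open>c\<close>. As \<open>c\<close> grows to \<open>d \<le> a m\<close>, the summand of \<open>m\<close> alone compensates the growth of the
  first term, so a further summand that is positive at \<open>c\<close> would make the value drop.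
\<close>

lemma truncated_sum_rigidity:
  fixes a :: "'b \<Rightarrow> nat"
  assumes fin: "finite T" and m: "m \<in> T" "d \<le> a m" and cd: "c < d"
    and le: "c + (\<Sum>t\<in>T. a t - c) \<le> d + (\<Sum>t\<in>T. a t - d)"
    and r: "r \<in> T" "r \<noteq> m"
  shows "a r \<le> c"
proof (rule ccontr)
  assume "\<not> a r \<le> c"
  then have "(\<Sum>t\<in>T - {m}. a t - d) < (\<Sum>t\<in>T - {m}. a t - c)"
    using fin r cd by (intro sum_strict_mono_ex1) (auto intro!: bexI[of _ r])
  moreover have "(\<Sum>t\<in>T. a t - c) = (a m - c) + (\<Sum>t\<in>T - {m}. a t - c)"
    "(\<Sum>t\<in>T. a t - d) = (a m - d) + (\<Sum>t\<in>T - {m}. a t - d)"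
    using fin m(1) by (simp_all add: sum.remove)
  ultimately show False using le m(2) cd by linarith
qed

locale sunflower =
  fixes n :: nat and T :: "nat set" and J :: "nat \<Rightarrow> nat set" and K :: "nat set"
    and a :: "nat \<Rightarrow> nat" and b :: nat
  assumes finite_T: "finite T"
    and J_subset: "\<And>t. t \<in> T \<Longrightarrow> J t \<subseteq> {1..n}"
    and K_subset: "K \<subseteq> {1..n}"
    and J_Int: "\<And>t r. t \<in> T \<Longrightarrow> r \<in> T \<Longrightarrow> t \<noteq> r \<Longrightarrow> J t \<inter> J r = (\<Inter>t\<in>T. J t)"
    and K_Int: "\<And>t. t \<in> T \<Longrightarrow> K \<inter> J t = {}"
    and b_pos: "0 < b"
begin

text \<open>
  For empty \<open>T\<close> the intersection is all of \<^typ>\<open>nat\<close>; the facts about the degree of the core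
  below therefore assume some \<open>t \<in> T\<close>.
\<close>

definition core :: "nat set" where "core = (\<Inter>t\<in>T. J t)"

definition petal :: "nat \<Rightarrow> nat set" where "petal t = J t - core"

definition members :: "monom set" where
  "members = {w \<in> monoms n. (\<forall>t\<in>T. a t \<le> part_deg (J t) w) \<and> b \<le> part_deg K w}"

lemma members_subset: "members \<subseteq> monoms n"
  by (auto simp: members_def)

lemma poly_span_members:
  "poly_span members = (\<Inter>t\<in>T. poly_span (deg_at_least n (J t) (a t)))
    \<inter> poly_span (deg_at_least n K b)"
  by (auto simp: poly_span_def members_def deg_at_least_def)

lemma multiples_members: "multiples n members \<subseteq> members"
  by (auto simp: multiples_def members_def part_deg_add intro: add_in_monoms trans_le_add1)

lemma finite_J: "t \<in> T \<Longrightarrow> finite (J t)"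
  using J_subset finite_subset by blast

lemma finite_K: "finite K"
  using K_subset finite_subset by blast

lemma core_subset: "t \<in> T \<Longrightarrow> core \<subseteq> J t"
  by (auto simp: core_def)

lemma finite_core: "t \<in> T \<Longrightarrow> finite core"
  using core_subset finite_J finite_subset by blast

lemma finite_petal: "t \<in> T \<Longrightarrow> finite (petal t)"
  by (simp add: petal_def finite_J)

lemma petal_notin_J: "t \<in> T \<Longrightarrow> r \<in> T \<Longrightarrow> t \<noteq> r \<Longrightarrow> i \<in> petal t \<Longrightarrow> i \<notin> J r"
  using J_Int[of t r] by (auto simp: petal_def core_def)

lemma part_deg_J:
  assumes "t \<in> T" shows "part_deg (J t) u = part_deg core u + part_deg (petal t) u"
proof -
  have "J t = core \<union> petal t" using core_subset[OF assms] by (auto simp: petal_def)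
  then show ?thesis
    using part_deg_Un[OF finite_core[OF assms] finite_petal[OF assms], of u]
    by (simp add: petal_def)
qed

text \<open>If no condition involving \<open>x\<^sub>i\<close> held with equality, one could divide by \<open>x\<^sub>i\<close>.\<close>

lemma minimal_tight:
  assumes u: "u \<in> minimal_monoms members" and i: "i \<in> Poly_Mapping.keys u"
  shows "i \<in> K \<and> part_deg K u = b \<or> (\<exists>t\<in>T. i \<in> J t \<and> part_deg (J t) u = a t)"
proof (rule ccontr)
  assume neg: "\<not> ?thesis"
  have u_mem: "u \<in> members" using u by (simp add: minimal_monoms_def)
  have "a t \<le> part_deg (J t) (u - var_monom i)" if t: "t \<in> T" for t
  proof -
    have "a t \<le> part_deg (J t) u" using u_mem t by (simp add: members_def)
    then show ?thesis
      using neg t part_deg_diff_var_monom[OF finite_J[OF t] i] by (cases "i \<in> J t") fastforce+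
  qed
  moreover have "b \<le> part_deg K (u - var_monom i)"
    using neg u_mem part_deg_diff_var_monom[OF finite_K i]
    by (cases "i \<in> K") (fastforce simp: members_def)+
  moreover have "u - var_monom i \<in> monoms n"
    using u_mem by (simp add: members_def diff_in_monoms)
  ultimately have "u - var_monom i \<in> members" by (simp add: members_def)
  then show False using u i by (simp add: minimal_monoms_def)
qed

lemma minimal_part_deg_K:
  assumes u: "u \<in> minimal_monoms members" shows "part_deg K u = b"
proof -
  have "0 < part_deg K u" using u b_pos by (auto simp: minimal_monoms_def members_def)
  then obtain i where "i \<in> K" "i \<in> Poly_Mapping.keys u" by (rule part_deg_pos)
  then show ?thesis using minimal_tight[OF u] K_Int by blast
qed

text \<open>
  A petal variable occurs in no condition other than that of its own petal, so if one divides
  \<open>u\<close>, that condition is tight. Otherwise the petal degree vanishes, and the truncated difference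
  does too because the core alone satisfies the condition.
\<close>

lemma minimal_part_deg_petal:
  assumes u: "u \<in> minimal_monoms members" and t: "t \<in> T"
  shows "part_deg (petal t) u = a t - part_deg core u"
proof (cases "part_deg (petal t) u = 0")
  case True
  have "a t \<le> part_deg (J t) u" using u t by (simp add: minimal_monoms_def members_def)
  then show ?thesis using True part_deg_J[OF t, of u] by simp
next
  case False
  then have "0 < part_deg (petal t) u" by simp
  then obtain i where i: "i \<in> petal t" "i \<in> Poly_Mapping.keys u" by (rule part_deg_pos)
  then have "i \<notin> K" using K_Int[OF t] by (auto simp: petal_def)
  then have "part_deg (J t) u = a t"
    using minimal_tight[OF u i(2)] petal_notin_J[OF t _ _ i(1)] by blast
  then show ?thesis using part_deg_J[OF t, of u] by simp
qed

text \<open>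
  A core variable of \<open>u\<close> lies in some tight condition \<open>J m\<close>, whose value \<open>a m\<close> bounds the degree on
  \<open>core \<subseteq> J m\<close>. This keeps core degrees in the range where the degree of a minimal monomial is a
  nonincreasing function of its core degree.
\<close>

lemma minimal_part_deg_core:
  assumes u: "u \<in> minimal_monoms members" and t: "t \<in> T"
  obtains m where "m \<in> T" "part_deg core u \<le> a m"
proof (cases "part_deg core u = 0")
  case False
  then have "0 < part_deg core u" by simp
  then obtain i where i: "i \<in> core" "i \<in> Poly_Mapping.keys u" by (rule part_deg_pos)
  then have "i \<notin> K" using K_Int[OF t] core_subset[OF t] by blast
  then obtain m where "m \<in> T" "part_deg (J m) u = a m"
    using minimal_tight[OF u i(2)] by blast
  then show thesis using that part_deg_J[of m u] by simp
qed (use that t in simp)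

lemma minimal_total_deg:
  assumes u: "u \<in> minimal_monoms members" and t: "t \<in> T"
  shows "total_deg u = b + (part_deg core u + (\<Sum>r\<in>T. a r - part_deg core u))"
proof -
  let ?petals = "\<Union>r\<in>T. petal r"
  have fin: "finite ?petals" using finite_T finite_petal by blast
  have "i \<in> K \<union> (core \<union> ?petals)" if "i \<in> Poly_Mapping.keys u" for i
    using minimal_tight[OF u that] by (auto simp: petal_def)
  then have "total_deg u = part_deg (K \<union> (core \<union> ?petals)) u"
    unfolding total_deg_def part_deg_def
    using finite_K finite_core[OF t] fin
    by (intro sum.mono_neutral_left) (auto simp: in_keys_iff)
  also have "\<dots> = part_deg K u + part_deg (core \<union> ?petals) u"
  proof (rule part_deg_Un)
    show "K \<inter> (core \<union> ?petals) = {}"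
      using K_Int core_subset[OF t] t by (fastforce simp: petal_def)
  qed (use finite_K finite_core[OF t] fin in auto)
  also have "part_deg (core \<union> ?petals) u = part_deg core u + part_deg ?petals u"
    by (rule part_deg_Un) (use finite_core[OF t] fin in \<open>auto simp: petal_def\<close>)
  also have "part_deg ?petals u = (\<Sum>r\<in>T. part_deg (petal r) u)"
    unfolding part_deg_def
  proof (rule sum.UNION_disjoint)
    show "\<forall>r\<in>T. \<forall>r'\<in>T. r \<noteq> r' \<longrightarrow> petal r \<inter> petal r' = {}"
      using petal_notin_J unfolding petal_def by blast
  qed (use finite_T finite_petal in auto)
  also have "\<dots> = (\<Sum>r\<in>T. a r - part_deg core u)"
    using minimal_part_deg_petal[OF u] by simp
  finally show ?thesis using minimal_part_deg_K[OF u] by simp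
qed

text \<open>
  Replacing \<open>x\<^sub>j\<close> by \<open>x\<^sub>i\<close> lowers a degree, by one, only on those sets that contain \<open>j\<close> but not \<open>i\<close>.
\<close>

lemma exchange_in_members:
  assumes v: "v \<in> members" and i: "i \<in> {1..n}" and j: "j \<in> Poly_Mapping.keys v"
    and K: "j \<in> K \<Longrightarrow> i \<in> K"
    and J: "\<And>t. t \<in> T \<Longrightarrow> j \<in> J t \<Longrightarrow> i \<notin> J t \<Longrightarrow> a t < part_deg (J t) v"
  shows "var_monom i + (v - var_monom j) \<in> members"
proof -
  let ?w = "var_monom i + (v - var_monom j)"
  have deg: "part_deg A ?w + (if j \<in> A then 1 else 0) = part_deg A v + (if i \<in> A then 1 else 0)"
    if "finite A" for A
    using part_deg_diff_var_monom[OF that j] part_deg_var_monom[OF that, of i]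
    by (simp add: part_deg_add)
  have "?w \<in> monoms n"
    using v i by (simp add: members_def add_in_monoms var_monom_in_monoms diff_in_monoms)
  moreover have "a t \<le> part_deg (J t) ?w" if t: "t \<in> T" for t
  proof -
    have "a t \<le> part_deg (J t) v" using v t by (simp add: members_def)
    then show ?thesis using deg[OF finite_J[OF t]] J[OF t] by (auto split: if_splits)
  qed
  moreover have "b \<le> part_deg K ?w"
    using v deg[OF finite_K] K by (auto simp: members_def split: if_splits)
  ultimately show ?thesis by (simp add: members_def)
qed

text \<open>
  The index \<open>j\<close> is taken from the part (\<open>K\<close>, core or petal) that contains \<open>i\<close> whenever that is
  possible. If it is not, \<open>v\<close> has too small a degree on that part and compensates for it elsewhere:
  on the petal of a large \<open>a m\<close> if \<open>i\<close> is in the core, and in the core if \<open>i\<close> is in a petal. The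
  hypothesis on total degrees is what makes the last case work.
\<close>

lemma exchange:
  assumes u: "u \<in> minimal_monoms members" and v: "v \<in> minimal_monoms members"
    and deg: "total_deg u \<le> total_deg v" and i: "var_deg i v < var_deg i u"
  obtains j where "var_deg j u < var_deg j v" "var_monom i + (v - var_monom j) \<in> members"
proof -
  have v_mem: "v \<in> members" using v by (simp add: minimal_monoms_def)
  have i_key: "i \<in> Poly_Mapping.keys u" using i by (simp add: in_keys_iff)
  then have i_n: "i \<in> {1..n}"
    using u by (auto simp: minimal_monoms_def members_def monoms_def)
  have key: "j \<in> Poly_Mapping.keys v" if "var_deg j u < var_deg j v" for j
    using that by (simp add: in_keys_iff)
  consider (K) "i \<in> K" | (core) t where "t \<in> T" "i \<in> core" | (petal) t where "t \<in> T" "i \<in> petal t"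
    using minimal_tight[OF u i_key] by (auto simp: petal_def)
  then show thesis
  proof cases
    case K
    have "part_deg K u \<le> part_deg K v" using u v by (simp add: minimal_part_deg_K)
    then obtain j where j: "j \<in> K" "var_deg j u < var_deg j v"
      using part_deg_exchange_witness[OF finite_K _ K i] by blast
    have "var_monom i + (v - var_monom j) \<in> members"
      using K_Int j(1) K by (intro exchange_in_members[OF v_mem i_n key[OF j(2)]]) blast+
    then show thesis using that j(2) by blast
  next
    case core
    show thesis
    proof (cases "part_deg core u \<le> part_deg core v")
      case True
      then obtain j where j: "j \<in> core" "var_deg j u < var_deg j v"
        using part_deg_exchange_witness[OF finite_core[OF core(1)] _ core(2) i] by blast
      have "var_monom i + (v - var_monom j) \<in> members"
        using K_Int[OF core(1)] core_subset j(1) core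
        by (intro exchange_in_members[OF v_mem i_n key[OF j(2)]]) blast+
      then show thesis using that j(2) by blast
    next
      case False
      \<comment> \<open>Condition \<open>m\<close> is not met by the core of \<open>v\<close> alone, since \<open>u\<close> has larger core degree.\<close>
      obtain m where m: "m \<in> T" "part_deg core u \<le> a m"
        using minimal_part_deg_core[OF u core(1)] by blast
      have "part_deg (petal m) u < part_deg (petal m) v"
        using False m(2)
        by (simp add: minimal_part_deg_petal[OF u m(1)] minimal_part_deg_petal[OF v m(1)])
      then obtain j where j: "j \<in> petal m" "var_deg j u < var_deg j v"
        by (rule part_deg_less_witness)
      have "var_monom i + (v - var_monom j) \<in> members"
      proof (rule exchange_in_members[OF v_mem i_n key[OF j(2)]])
        show "i \<in> K" if "j \<in> K" using that K_Int[OF m(1)] j(1) by (auto simp: petal_def)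
      qed (use core_subset core(2) in blast)
      then show thesis using that j(2) by blast
    qed
  next
    case petal
    note t = petal(1)
    show thesis
    proof (cases "part_deg (petal t) u \<le> part_deg (petal t) v")
      case True
      then obtain j where j: "j \<in> petal t" "var_deg j u < var_deg j v"
        using part_deg_exchange_witness[OF finite_petal[OF t] _ petal(2) i] by blast
      have "var_monom i + (v - var_monom j) \<in> members"
      proof (rule exchange_in_members[OF v_mem i_n key[OF j(2)]])
        show "i \<in> K" if "j \<in> K" using that K_Int[OF t] j(1) by (auto simp: petal_def)
        show "a r < part_deg (J r) v" if "r \<in> T" "j \<in> J r" "i \<notin> J r" for r
          using that petal_notin_J[OF t that(1) _ j(1)] petal(2) by (auto simp: petal_def)
      qed
      then show thesis using that j(2) by blast
    next
      case False
      then have lt: "part_deg core u < part_deg core v" "part_deg core u < a t"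
        by (auto simp: minimal_part_deg_petal[OF u t] minimal_part_deg_petal[OF v t])
      obtain m where m: "m \<in> T" "part_deg core v \<le> a m"
        using minimal_part_deg_core[OF v t] by blast
      have "part_deg core u + (\<Sum>r\<in>T. a r - part_deg core u)
          \<le> part_deg core v + (\<Sum>r\<in>T. a r - part_deg core v)"
        using deg unfolding minimal_total_deg[OF u t] minimal_total_deg[OF v t]
        by (rule add_le_imp_le_left)
      note small = truncated_sum_rigidity[OF finite_T m lt(1) this]
      \<comment> \<open>By rigidity only \<open>a m\<close> can exceed the core degree of \<open>u\<close>, and \<open>a t\<close> does. So for \<open>r \<noteq> t\<close>
        the core of \<open>v\<close> alone exceeds \<open>a r\<close>, and a core variable of \<open>v\<close> can be given up.\<close>
      have "t = m" using small[OF t] lt(2) by fastforce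
      obtain j where j: "j \<in> core" "var_deg j u < var_deg j v"
        using lt(1) by (rule part_deg_less_witness)
      have "var_monom i + (v - var_monom j) \<in> members"
      proof (rule exchange_in_members[OF v_mem i_n key[OF j(2)]])
        show "i \<in> K" if "j \<in> K" using that K_Int[OF t] core_subset[OF t] j(1) by blast
        show "a r < part_deg (J r) v" if r: "r \<in> T" "i \<notin> J r" for r
        proof -
          have "r \<noteq> m" using r petal(2) \<open>t = m\<close> by (auto simp: petal_def)
          then show ?thesis using small[OF r(1)] lt(1) part_deg_J[OF r(1), of v] by simp
        qed
      qed
      then show thesis using that j(2) by blast
    qed
  qed
qed

end

theorem theorem2p1:
  fixes n s b :: nat and J :: "nat \<Rightarrow> nat set" and K :: "nat set" and a :: "nat \<Rightarrow> nat"
    and I :: "(monom \<Rightarrow>\<^sub>0 'k::field) set"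
  assumes "\<And>t. t \<in> {1..s} \<Longrightarrow> J t \<subseteq> {1..n}"
    and "K \<subseteq> {1..n}"
    and "\<And>i j. 1 \<le> i \<Longrightarrow> i < j \<Longrightarrow> j \<le> s \<Longrightarrow> J i \<inter> J j = (\<Inter>t\<in>{1..s}. J t)"
    and "\<And>t. t \<in> {1..s} \<Longrightarrow> K \<inter> J t = {}"
    and "\<And>t. t \<in> {1..s} \<Longrightarrow> a t > 0"
    and "b > 0"
    and "I = (\<Inter>t\<in>{1..s}. ideal_pow n (var_ideal n (J t)) (a t)) \<inter> ideal_pow n (var_ideal n K) b"
  shows "nonpure_dual_exchange n I"
proof -
  interpret sunflower n "{1..s}" J K a b
  proof
    fix t r assume "t \<in> {1..s}" "r \<in> {1..s}" "t \<noteq> r"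
    then show "J t \<inter> J r = (\<Inter>t\<in>{1..s}. J t)"
      by (metis assms(3) Int_commute atLeastAtMost_iff linorder_neqE_nat)
  qed (rule finite_atLeastAtMost assms(1,2,4,6) | assumption)+
  have I: "I = poly_span members"
    unfolding assms(7) poly_span_members ideal_pow_var_ideal[OF assms(2)]
    using ideal_pow_var_ideal[OF assms(1), where 'k = 'k] by (metis (mono_tags, lifting) INF_cong)
  have gens: "min_gens n I = minimal_monoms members" and mono: "monomial_ideal n I"
    unfolding I by (rule min_gens_poly_span[OF members_subset multiples_members])+
  show ?thesis
    unfolding nonpure_dual_exchange_def gens
  proof (intro conjI ballI impI mono)
    fix u v i
    assume uv: "u \<in> minimal_monoms members" "v \<in> minimal_monoms members"
      and deg: "total_deg u \<le> total_deg v" and i: "var_deg i v < var_deg i u"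
    obtain j where j: "var_deg j u < var_deg j v"
        "var_monom i + (v - var_monom j) \<in> members"
      by (rule exchange[OF uv deg i])
    have "v \<in> monoms n" using uv(2) members_subset unfolding minimal_monoms_def by blast
    moreover have "j \<in> Poly_Mapping.keys v" using j(1) by (simp add: in_keys_iff)
    ultimately have "j \<in> {1..n}" unfolding monoms_def by blast
    then show "\<exists>j\<in>{1..n}. var_deg j u < var_deg j v
        \<and> mon_poly (var_monom i + (v - var_monom j)) \<in> I"
      using j unfolding I mon_poly_in_poly_span by blast
  qed
qed

end
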